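(* Let $\mathcal{A}$ be an infinite sequence of positive integers. Then for every integer $k\ge 2$, the number of solutions of the equation $n=a_1+\dots+a_k$ with $a_1,\dots,a_k\in\mathcal{A}$ is not constant for $n$ large enough; that is, there do not exist a constant $c$ and an integer $N$ such that this number of solutions equals $c$ for all integers $n>N$.
   Context: An infinite sequence of positive integers $\mathcal{A}$ is regarded as an infinite set of (distinct) positive integers. Solutions are counted as ordered $k$-tuples $(a_1,\dots,a_k)\in\mathcal{A}^k$. *)

theory Defs
  imports Main
begin

text \<open>Ordered \<open>k\<close>-tuples over \<open>A\<close> are encoded as lists of length \<open>k\<close> with entries in \<open>A\<close>.\<close>

definition solutions :: "nat set \<Rightarrow> nat \<Rightarrow> nat \<Rightarrow> nat list set" where
  "solutions A k n = {as. length as = k \<and> set as \<subseteq> A \<and> sum_list as = n}"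

text \<open>\<^const>\<open>card\<close> returns 0 on infinite sets; the next lemma shows that this case does not occur.\<close>

lemma finite_solutions: "finite (solutions A k n)"
proof (rule finite_subset)
  show "solutions A k n \<subseteq> {as. set as \<subseteq> {..n} \<and> length as = k}"
    by (auto simp: solutions_def intro: member_le_sum_list)
  show "finite {as. set as \<subseteq> {..n} \<and> length as = k}"
    by (rule finite_lists_length_eq) simp
qed

definition num_solutions :: "nat set \<Rightarrow> nat \<Rightarrow> nat \<Rightarrow> nat" where
  "num_solutions A k n = card (solutions A k n)"

end

theory Submission
  imports Defs "HOL-Computational_Algebra.Polynomial_FPS"
begin

text \<open>Let \<open>f = (\<Sum>a\<in>A. X\<^sup>a)\<close> be the generating function of \<open>A\<close>. The coefficients of \<open>f ^ k\<close> count the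
  representations as sums of \<open>k\<close> elements of \<open>A\<close> (\<open>indicator_power_nth\<close>), so if these counts are
  eventually equal to \<open>c\<close>, then \<open>(X - 1) f ^ k = P\<close> for a polynomial \<open>P\<close> with \<open>P(1) = - c\<close>; as \<open>A\<close> is
  infinite, \<open>c \<noteq> 0\<close>. In other words, \<open>f ^ k\<close> is a rational function with a simple pole at \<open>1\<close>.

  If \<open>f\<close> itself were a rational function, the order of the pole of \<open>f ^ k\<close> would be a multiple of
  \<open>k \<ge> 2\<close>, a contradiction (\<open>simple_pole_not_power\<close>). The point is therefore that \<open>f\<close> is rational.
  It is certainly algebraic, and its logarithmic derivative is rational, so that it satisfies a
  differential equation \<open>Q f' = R f\<close> with polynomial coefficients (\<open>deriv_of_root\<close>). Together with
  the boundedness of the integer coefficients of \<open>f\<close> this forces \<open>Q f\<close> to be a polynomial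
  (\<open>polynomial_multiple_if_bounded\<close>): the derivative of \<open>Q f\<close> is \<open>(Q' + R) f\<close> and has bounded
  coefficients, while the \<open>n\<close>-th coefficient of a derivative is divisible by \<open>n + 1\<close>.\<close>

section \<open>The generating function of the number of representations\<close>

unbundle fps_syntax

definition indicator_fps :: "nat set \<Rightarrow> int fps" where
  "indicator_fps A = Abs_fps (\<lambda>n. if n \<in> A then 1 else 0)"

lemma indicator_fps_nth: "indicator_fps A $ n = (if n \<in> A then 1 else 0)"
  by (simp add: indicator_fps_def)

lemma num_solutions_0: "num_solutions A 0 n = (if n = 0 then 1 else 0)"
proof -
  have "solutions A 0 n = (if n = 0 then {[]} else {})"
    by (auto simp: solutions_def)
  then show ?thesis by (simp add: num_solutions_def)
qed

lemma num_solutions_Suc: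
  "num_solutions A (Suc k) n = (\<Sum>a\<in>{a. a \<le> n \<and> a \<in> A}. num_solutions A k (n - a))"
proof -
  let ?I = "{a. a \<le> n \<and> a \<in> A}"
  have eq: "solutions A (Suc k) n = (\<Union>a\<in>?I. (#) a ` solutions A k (n - a))"
  proof (intro equalityI subsetI)
    fix as assume as: "as \<in> solutions A (Suc k) n"
    then obtain a bs where "as = a # bs" "length bs = k"
      by (auto simp: solutions_def length_Suc_conv)
    with as have "a \<in> ?I" "bs \<in> solutions A k (n - a)" by (auto simp: solutions_def)
    with \<open>as = a # bs\<close> show "as \<in> (\<Union>a\<in>?I. (#) a ` solutions A k (n - a))" by blast
  qed (auto simp: solutions_def)
  have "card (\<Union>a\<in>?I. (#) a ` solutions A k (n - a))
      = (\<Sum>a\<in>?I. card ((#) a ` solutions A k (n - a)))"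
    by (rule card_UN_disjoint) (auto simp: finite_solutions)
  then show ?thesis
    by (simp add: num_solutions_def eq card_image)
qed

lemma indicator_power_nth: "(indicator_fps A ^ k) $ n = int (num_solutions A k n)"
proof (induction k arbitrary: n)
  case 0
  then show ?case by (simp add: num_solutions_0)
next
  case (Suc k)
  have "(indicator_fps A ^ Suc k) $ n
      = (\<Sum>a=0..n. indicator_fps A $ a * int (num_solutions A k (n - a)))"
    by (simp add: fps_mult_nth Suc.IH)
  also have "\<dots> = (\<Sum>a=0..n. if a \<in> A then int (num_solutions A k (n - a)) else 0)"
    by (rule sum.cong) (auto simp: indicator_fps_nth)
  also have "\<dots> = (\<Sum>a\<in>{a\<in>{0..n}. a \<in> A}. int (num_solutions A k (n - a)))"
    by (rule sum.inter_filter [symmetric]) simp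
  also have "\<dots> = int (num_solutions A (Suc k) n)"
    by (simp add: num_solutions_Suc)
  finally show ?case .
qed

section \<open>Power series with eventually constant coefficients\<close>

lemma fps_eq_poly_if_eventually_0:
  assumes "\<And>n. n \<ge> N \<Longrightarrow> g $ n = 0"
  shows "g = fps_of_poly (truncate_fps N g)"
  using assms by (intro fps_ext) (simp add: coeff_truncate_fps)

lemma eventually_const_imp_simple_pole:
  fixes g :: "int fps"
  assumes "\<And>n. n > N \<Longrightarrow> g $ n = c"
  obtains P where "fps_of_poly [:-1, 1:] * g = fps_of_poly P" "poly P 1 = - c"
proof
  let ?T = "truncate_fps (Suc N) g"
  let ?h = "g - fps_of_poly ?T"
  let ?P = "[:-1, 1:] * ?T - monom c (Suc N)"
  have X1: "fps_of_poly [:-1, 1:] = fps_X - (1 :: int fps)"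
    by (simp add: fps_of_poly_pCons numeral_fps_const flip: fps_const_neg)
  have "fps_of_poly [:-1, 1:] * ?h = - fps_of_poly (monom c (Suc N))"
  proof (rule fps_ext)
    fix n
    show "(fps_of_poly [:-1, 1:] * ?h) $ n = (- fps_of_poly (monom c (Suc N))) $ n"
      using assms by (cases n) (auto simp: X1 left_diff_distrib coeff_truncate_fps)
  qed
  then show "fps_of_poly [:-1, 1:] * g = fps_of_poly ?P"
    by (simp only: fps_of_poly_diff fps_of_poly_mult right_diff_distrib diff_eq_eq
        uminus_add_conv_diff diff_add_cancel)
  show "poly ?P 1 = - c" by (simp add: poly_monom)
qed

section \<open>Rationality from a differential equation\<close>

text \<open>A bounded sequence of integers whose \<open>n\<close>-th term is divisible by \<open>n + 1\<close> vanishes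
  eventually. This applies to the coefficients of the derivative of \<open>Q f\<close>.\<close>

lemma polynomial_multiple_if_bounded:
  fixes f :: "int fps" and Q R :: "int poly"
  assumes ode: "fps_of_poly Q * fps_deriv f = fps_of_poly R * f"
    and bounded: "\<And>n. \<bar>f $ n\<bar> \<le> B"
  obtains S where "fps_of_poly Q * f = fps_of_poly S"
proof -
  define g where "g = fps_of_poly Q * f"
  define W where "W = pderiv Q + R"
  define M where "M = (\<Sum>i\<le>degree W. \<bar>coeff W i\<bar>) * B"
  have deriv: "fps_deriv g = fps_of_poly W * f"
    using ode by (simp add: g_def W_def fps_of_poly_add fps_of_poly_pderiv algebra_simps)
  have le_M: "\<bar>(fps_of_poly W * f) $ n\<bar> \<le> M" for n
  proof -
    have "B \<ge> 0" using bounded[of 0] by linarith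
    have "\<bar>(fps_of_poly W * f) $ n\<bar> = \<bar>\<Sum>i=0..n. coeff W i * f $ (n - i)\<bar>"
      by (simp add: fps_mult_nth)
    also have "\<dots> \<le> (\<Sum>i=0..n. \<bar>coeff W i * f $ (n - i)\<bar>)" by (rule sum_abs)
    also have "\<dots> \<le> (\<Sum>i=0..n. \<bar>coeff W i\<bar> * B)"
      by (intro sum_mono) (simp add: abs_mult bounded mult_left_mono)
    also have "\<dots> \<le> (\<Sum>i\<in>{0..n} \<union> {..degree W}. \<bar>coeff W i\<bar> * B)"
      using \<open>B \<ge> 0\<close> by (intro sum_mono2) auto
    also have "\<dots> = (\<Sum>i\<le>degree W. \<bar>coeff W i\<bar> * B)"
      by (intro sum.mono_neutral_right) (auto simp: coeff_eq_0)
    finally show ?thesis by (simp add: M_def sum_distrib_right)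
  qed
  have "g $ n = 0" if "n \<ge> Suc (nat M)" for n
  proof (rule ccontr)
    assume "g $ n \<noteq> 0"
    from that obtain m where n: "n = Suc m" by (cases n) auto
    have "int n * g $ n = (fps_of_poly W * f) $ m"
      using arg_cong[OF deriv, of "\<lambda>h. h $ m"] by (simp add: n)
    with le_M[of m] have "int n * \<bar>g $ n\<bar> \<le> M" by (metis abs_mult abs_of_nat)
    moreover have "int n * 1 \<le> int n * \<bar>g $ n\<bar>"
      using \<open>g $ n \<noteq> 0\<close> by (intro mult_left_mono) auto
    ultimately show False using that by linarith
  qed
  then have "g = fps_of_poly (truncate_fps (Suc (nat M)) g)"
    by (rule fps_eq_poly_if_eventually_0)
  then show ?thesis unfolding g_def by (rule that)
qed

text \<open>Logarithmic differentiation of \<open>D f\<^sup>k = P\<close> gives \<open>k f' / f = P' / P - D' / D\<close>; the identity below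
  is the version with cleared denominators.\<close>

lemma deriv_of_root:
  fixes f :: "'a :: idom fps"
  assumes "fps_of_poly D * f ^ k = fps_of_poly P" and "k > 0"
  shows "fps_of_poly (of_nat k * P * D) * fps_deriv f
       = fps_of_poly (D * pderiv P - pderiv D * P) * f"
proof -
  define d where "d = fps_of_poly D"
  define p where "p = fps_of_poly P"
  have p: "p = d * f ^ k" using assms by (simp add: p_def d_def)
  have pw: "f ^ k = f * f ^ (k - 1)" using \<open>k > 0\<close> by (simp add: power_eq_if)
  have k: "fps_of_poly (of_nat k) = of_nat k"
    by (simp add: of_nat_poly fps_of_poly_const fps_of_nat)
  have "fps_deriv p = fps_deriv d * f ^ k + d * (of_nat k * fps_deriv f * f ^ (k - 1))"
    by (simp add: p fps_deriv_power' algebra_simps)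
  then have "(d * fps_deriv p - fps_deriv d * p) * f = of_nat k * p * d * fps_deriv f"
    by (simp add: p pw algebra_simps)
  then show ?thesis
    by (simp add: fps_of_poly_mult fps_of_poly_diff fps_of_poly_pderiv k d_def p_def)
qed

text \<open>The hypothesis says that \<open>(S / (T (X - a)))\<^sup>k = P / (X - a)\<close>. When \<open>T\<close> and \<open>P\<close> do not vanish at \<open>a\<close>,
  the right side has a simple pole at \<open>a\<close>, whereas the order of a pole of a \<open>k\<close>-th power is a
  multiple of \<open>k\<close>.\<close>

lemma simple_pole_not_power:
  fixes S T P :: "'a :: idom poly"
  assumes eq: "S ^ k * [:-a, 1:] = (T * [:-a, 1:]) ^ k * P" and "k \<ge> 2"
  shows "poly T a = 0 \<or> poly P a = 0"
proof -
  define D where "D = [:-a, 1:]"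
  have D: "D \<noteq> 0" "poly D a = 0" by (simp_all add: D_def)
  obtain j where k: "k = Suc (Suc j)" using \<open>k \<ge> 2\<close> by (metis add_2_eq_Suc le_Suc_ex)
  have "D * S ^ k = D * (T ^ k * D ^ Suc j * P)"
    using eq by (simp add: D_def[symmetric] k power_mult_distrib algebra_simps)
  with D have S: "S ^ k = T ^ k * D ^ Suc j * P" by (metis mult_left_cancel)
  then have "poly (S ^ k) a = 0" using D by simp
  then have "poly S a = 0" by simp
  then obtain U where U: "S = D * U" by (auto simp: poly_eq_0_iff_dvd D_def elim: dvdE)
  have "D ^ Suc j * (D * U ^ k) = D ^ Suc j * (T ^ k * P)"
    using S by (simp add: U k power_mult_distrib algebra_simps)
  with D have "D * U ^ k = T ^ k * P" by (metis mult_left_cancel power_not_zero)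
  then have "poly (T ^ k * P) a = 0" using D by (metis mult_zero_left poly_mult)
  then show ?thesis by auto
qed

section \<open>The number of representations is not eventually constant\<close>

theorem mainTheorem3:
  fixes A :: "nat set" and k :: nat
  assumes "infinite A"
    and "\<forall>a\<in>A. a > 0"
    and "k \<ge> 2"
  shows "\<not> (\<exists>c N. \<forall>n>N. num_solutions A k n = c)"
proof
  assume "\<exists>c N. \<forall>n>N. num_solutions A k n = c"
  then obtain c N where const: "\<And>n. n > N \<Longrightarrow> num_solutions A k n = c" by blast
  define f where "f = indicator_fps A"
  define D :: "int poly" where "D = [:-1, 1:]"
  have "c \<noteq> 0"
  proof -
    obtain a where a: "a \<in> A" "a > N" using \<open>infinite A\<close> by (meson infinite_nat_iff_unbounded)
    have "1 * a \<le> k * a" using \<open>k \<ge> 2\<close> by (intro mult_right_mono) auto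
    with a have "k * a > N" by linarith
    then have "c = num_solutions A k (k * a)" by (simp add: const)
    moreover have "replicate k a \<in> solutions A k (k * a)"
      using a by (auto simp: solutions_def sum_list_replicate)
    ultimately show ?thesis
      using finite_solutions[of A k "k * a"] by (auto simp: num_solutions_def)
  qed
  have "(f ^ k) $ n = int c" if "n > N" for n
    using that by (simp add: f_def indicator_power_nth const)
  then obtain P where P: "fps_of_poly D * f ^ k = fps_of_poly P" and P1: "poly P 1 = - int c"
    unfolding D_def by (rule eventually_const_imp_simple_pole)
  have "\<bar>f $ n\<bar> \<le> 1" for n by (simp add: f_def indicator_fps_nth)
  moreover have "k > 0" using \<open>k \<ge> 2\<close> by simp
  ultimately obtain S where S: "fps_of_poly (of_nat k * P * D) * f = fps_of_poly S"
    using polynomial_multiple_if_bounded[OF deriv_of_root[OF P]] by blast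
  have "fps_of_poly (S ^ k * D) = (fps_of_poly (of_nat k * P * D) * f) ^ k * fps_of_poly D"
    by (simp only: S fps_of_poly_mult[of "S ^ k"] fps_of_poly_power)
  also have "\<dots> = fps_of_poly (of_nat k * P * D) ^ k * (fps_of_poly D * f ^ k)"
    by (simp add: power_mult_distrib mult_ac)
  also have "\<dots> = fps_of_poly ((of_nat k * P * D) ^ k * P)"
    by (simp add: P fps_of_poly_mult fps_of_poly_power)
  finally have "S ^ k * D = (of_nat k * P * D) ^ k * P" by (simp add: fps_of_poly_eq_iff)
  then have "poly (of_nat k * P) 1 = 0 \<or> poly P 1 = 0"
    unfolding D_def using \<open>k \<ge> 2\<close> by (rule simple_pole_not_power)
  with P1 \<open>c \<noteq> 0\<close> \<open>k \<ge> 2\<close> show False by (simp add: of_nat_poly)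
qed

end
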